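(* Assume Martin's axiom. Then there exist free ultrafilters $\mathcal U_1, \mathcal U_2$ on $\mathbb N$ and a topological vector space $X$ such that $X \in \mathrm{Compl}(\mathcal U_1)$ but $X \notin \mathrm{Compl}(\mathcal U_2)$.
   Context: "Topological vector space" (TVS) means a Hausdorff topological vector space over $\mathbb K \in \{\mathbb R, \mathbb C\}$. A filter on $\mathbb N$ is free if it contains the Fréchet filter of all cofinite subsets of $\mathbb N$; an ultrafilter is a maximal (proper) filter. For a filter $\mathcal F$ on $\mathbb N$, a sequence $(x_n) \subset X$ is a Cauchy sequence over $\mathcal F$ if for every neighborhood $U$ of $0$ there is $B \in \mathcal F$ with $x_n - x_m \in U$ for all $n,m \in B$; it has limit $y \in X$ over $\mathcal F$ if for every neighborhood $V$ of $y$ there is $B \in \mathcal F$ with $x_n \in V$ for all $n \in B$. $X$ is complete over $\mathcal F$, written $X \in \mathrm{Compl}(\mathcal F)$, if every Cauchy sequence over $\mathcal F$ in $X$ has a limit over $\mathcal F$ in $X$. *)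

theory Defs
  imports
    "HOL-Analysis.Analysis"
    "HOL-Algebra.Module"
    "HOL-Library.Equipollence"
begin

section \<open>Martin's axiom\<close>

text \<open>Forcing convention: the smaller element is the stronger one.\<close>

definition compatible_in :: "'p set \<Rightarrow> 'p rel \<Rightarrow> 'p \<Rightarrow> 'p \<Rightarrow> bool" where
  "compatible_in P r p q \<longleftrightarrow> (\<exists>s\<in>P. (s, p) \<in> r \<and> (s, q) \<in> r)"

definition ccc :: "'p set \<Rightarrow> 'p rel \<Rightarrow> bool" where
  "ccc P r \<longleftrightarrow>
     (\<forall>A\<subseteq>P. (\<forall>p\<in>A. \<forall>q\<in>A. p \<noteq> q \<longrightarrow> \<not> compatible_in P r p q) \<longrightarrow> countable A)"

definition dense_in_poset :: "'p set \<Rightarrow> 'p rel \<Rightarrow> 'p set \<Rightarrow> bool" where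
  "dense_in_poset P r D \<longleftrightarrow> D \<subseteq> P \<and> (\<forall>p\<in>P. \<exists>d\<in>D. (d, p) \<in> r)"

definition poset_filter :: "'p set \<Rightarrow> 'p rel \<Rightarrow> 'p set \<Rightarrow> bool" where
  "poset_filter P r G \<longleftrightarrow>
     G \<subseteq> P \<and> G \<noteq> {} \<and>
     (\<forall>p\<in>G. \<forall>q\<in>P. (p, q) \<in> r \<longrightarrow> q \<in> G) \<and>
     (\<forall>p\<in>G. \<forall>q\<in>G. \<exists>s\<in>G. (s, p) \<in> r \<and> (s, q) \<in> r)"

definition martin_axiom_on :: "'p itself \<Rightarrow> bool" where
  "martin_axiom_on _ \<longleftrightarrow>
     (\<forall>(P :: 'p set) r \<D>.
        P \<noteq> {} \<and> partial_order_on P r \<and> ccc P r \<and>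
        (\<forall>D\<in>\<D>. dense_in_poset P r D) \<and> \<D> \<prec> (UNIV :: real set) \<longrightarrow>
        (\<exists>G. poset_filter P r G \<and> (\<forall>D\<in>\<D>. G \<inter> D \<noteq> {})))"

text \<open>A formula cannot quantify over types, so the axiom is stated for the posets carried by
  arbitrary sets of reals. Nothing is lost: by \<open>martin_axiom_imp_on\<close> below it implies the
  axiom for posets over every type.\<close>

definition martin_axiom :: bool where
  "martin_axiom \<longleftrightarrow> martin_axiom_on TYPE(real)"

lemma card_of_ordLeq_iff_lepoll: "(card_of A, card_of B) \<in> ordLeq \<longleftrightarrow> A \<lesssim> B"
  by (simp add: lepoll_def card_of_ordLeq[symmetric])

lemma Un_lepoll_infinite: "A \<lesssim> C \<Longrightarrow> B \<lesssim> C \<Longrightarrow> infinite C \<Longrightarrow> A \<union> B \<lesssim> C"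
  using card_of_UNION_ordLeq_infinite[of C "UNIV :: bool set" "\<lambda>b. if b then A else B"]
    finite_lepoll_infinite[of C "UNIV :: bool set"]
  by (simp add: card_of_ordLeq_iff_lepoll UNIV_bool Un_commute)

lemma Times_lepoll_infinite: "A \<lesssim> C \<Longrightarrow> B \<lesssim> C \<Longrightarrow> infinite C \<Longrightarrow> A \<times> B \<lesssim> C"
  using card_of_Sigma_ordLeq_infinite[of C A "\<lambda>_. B"] by (simp add: card_of_ordLeq_iff_lepoll)

lemma martin_axiom_imp_on:
  assumes "martin_axiom"
  shows "martin_axiom_on TYPE('p)"
  unfolding martin_axiom_on_def
proof (intro allI impI, elim conjE)
  fix P :: "'p set" and r \<D>
  assume ne: "P \<noteq> {}" and po: "partial_order_on P r" and ccc: "ccc P r"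
    and dense: "\<forall>D\<in>\<D>. dense_in_poset P r D" and small: "\<D> \<prec> (UNIV :: real set)"
  have rfl: "(p, p) \<in> r" if "p \<in> P" for p
    using po that by (auto simp: partial_order_on_def preorder_on_def refl_on_def)
  have trn: "(p, s) \<in> r" if "(p, q) \<in> r" "(q, s) \<in> r" for p q s
    using po that by (meson partial_order_on_def preorder_on_def transD)
  have asym: "p = q" if "(p, q) \<in> r" "(q, p) \<in> r" for p q
    using po that by (meson partial_order_on_def antisymD)
  obtain p0 where p0: "p0 \<in> P" using ne by blast
  define m where "m = (\<lambda>(p, q). if compatible_in P r p q
      then SOME s. s \<in> P \<and> (s, p) \<in> r \<and> (s, q) \<in> r else p0)"
  define e where "e = (\<lambda>(D, p). SOME d. d \<in> D \<and> (d, p) \<in> r)"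
  have m: "m (p, q) \<in> P \<and> (m (p, q), p) \<in> r \<and> (m (p, q), q) \<in> r"
    if "compatible_in P r p q" for p q
    using someI_ex[of "\<lambda>s. s \<in> P \<and> (s, p) \<in> r \<and> (s, q) \<in> r"] that
    by (auto simp: m_def compatible_in_def)
  have mP: "m (p, q) \<in> P" for p q
    using m[of p q] p0 by (cases "compatible_in P r p q") (auto simp: m_def)
  have e: "e (D, p) \<in> D \<and> (e (D, p), p) \<in> r" if "D \<in> \<D>" "p \<in> P" for D p
  proof -
    have "\<exists>d. d \<in> D \<and> (d, p) \<in> r" using dense that unfolding dense_in_poset_def by blast
    from someI_ex[OF this] show ?thesis by (simp add: e_def)
  qed
  define Q where "Q = rec_nat {p0} (\<lambda>_ S. S \<union> m ` (S \<times> S) \<union> e ` (\<D> \<times> S))"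
  have Q0: "Q 0 = {p0}"
    and QS: "Q (Suc n) = Q n \<union> m ` (Q n \<times> Q n) \<union> e ` (\<D> \<times> Q n)" for n
    by (simp_all add: Q_def)
  define R where "R = (\<Union>n. Q n)"
  have QP: "Q n \<subseteq> P" for n
  proof (induction n)
    case 0
    then show ?case by (simp add: Q0 p0)
  next
    case (Suc n)
    have "e (D, p) \<in> P" if "D \<in> \<D>" "p \<in> Q n" for D p
      using e[of D p] that Suc dense unfolding dense_in_poset_def by blast
    then show ?case using Suc mP by (auto simp: QS)
  qed
  then have RP: "R \<subseteq> P" by (auto simp: R_def)
  have mono: "Q i \<subseteq> Q j" if "i \<le> j" for i j
    using lift_Suc_mono_le[of Q i j] that by (auto simp: QS)
  have Rm: "m (p, q) \<in> R" if pq: "p \<in> R" "q \<in> R" for p q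
  proof -
    obtain i j where "p \<in> Q i" "q \<in> Q j" using pq by (auto simp: R_def)
    then have "p \<in> Q (max i j)" "q \<in> Q (max i j)"
      using mono[of i "max i j"] mono[of j "max i j"] by auto
    then have "m (p, q) \<in> Q (Suc (max i j))" by (auto simp: QS)
    then show ?thesis by (auto simp: R_def)
  qed
  have Re: "e (D, p) \<in> R" if Dp: "D \<in> \<D>" "p \<in> R" for D p
  proof -
    obtain i where "p \<in> Q i" using Dp by (auto simp: R_def)
    then have "e (D, p) \<in> Q (Suc i)" using Dp by (auto simp: QS)
    then show ?thesis by (auto simp: R_def)
  qed
  have infR: "infinite (UNIV :: real set)" by (rule infinite_UNIV_char_0)
  note un = Un_lepoll_infinite[OF _ _ infR] and tim = Times_lepoll_infinite[OF _ _ infR]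
  have Qle: "Q n \<lesssim> (UNIV :: real set)" for n
  proof (induction n)
    case 0
    then show ?case by (simp add: Q0 lepoll_def)
  next
    case (Suc n)
    have D: "\<D> \<lesssim> (UNIV :: real set)" using small by (simp add: lesspoll_def)
    show ?case unfolding QS
      by (intro un Suc lepoll_trans[OF image_lepoll] tim D)
  qed
  have nle: "(UNIV :: nat set) \<lesssim> (UNIV :: real set)"
    using infR by (simp add: infinite_le_lepoll)
  have "R \<lesssim> (UNIV :: real set)"
    unfolding R_def using card_of_UNION_ordLeq_infinite[OF infR, of UNIV Q] nle Qle
    by (simp add: card_of_ordLeq_iff_lepoll)
  then obtain f :: "'p \<Rightarrow> real" where f: "inj_on f R" by (auto simp: lepoll_def)
  define s where "s = {(f p, f q) | p q. p \<in> R \<and> q \<in> R \<and> (p, q) \<in> r}"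
  have s: "(f p, f q) \<in> s \<longleftrightarrow> (p, q) \<in> r" if "p \<in> R" "q \<in> R" for p q
    using that f by (auto simp: s_def inj_on_def)
  have compat: "compatible_in (f ` R) s (f p) (f q)"
    if "p \<in> R" "q \<in> R" "compatible_in P r p q" for p q
    using that m[of p q] Rm[of p q] s by (auto simp: compatible_in_def)
  have "f ` R \<noteq> {}" using Q0 by (auto simp: R_def)
  moreover have "partial_order_on (f ` R) s"
  proof -
    have "s \<subseteq> f ` R \<times> f ` R" by (auto simp: s_def)
    moreover have "refl_on (f ` R) s"
      using s rfl RP by (auto simp: refl_on_def)
    moreover have "trans s"
    proof (rule transI)
      fix x y z assume "(x, y) \<in> s" "(y, z) \<in> s"
      then obtain a b b' c where "x = f a" "y = f b" "y = f b'" "z = f c"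
        "a \<in> R" "b \<in> R" "b' \<in> R" "c \<in> R" "(a, b) \<in> r" "(b', c) \<in> r"
        by (auto simp: s_def)
      moreover have "b = b'" using calculation f by (auto simp: inj_on_def)
      ultimately show "(x, z) \<in> s" using trn s by blast
    qed
    moreover have "antisym s"
    proof (rule antisymI)
      fix x y assume "(x, y) \<in> s" "(y, x) \<in> s"
      then obtain a b where "x = f a" "y = f b" "a \<in> R" "b \<in> R"
        by (auto simp: s_def)
      then show "x = y" using s asym \<open>(x, y) \<in> s\<close> \<open>(y, x) \<in> s\<close> by blast
    qed
    ultimately show ?thesis by (simp add: partial_order_on_def preorder_on_def)
  qed
  moreover have "ccc (f ` R) s"
    unfolding ccc_def
  proof (intro allI impI)
    fix A assume A: "A \<subseteq> f ` R"
      and anti: "\<forall>p\<in>A. \<forall>q\<in>A. p \<noteq> q \<longrightarrow> \<not> compatible_in (f ` R) s p q"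
    obtain B where B: "B \<subseteq> R" "A = f ` B" using A by (meson subset_imageE)
    have "\<not> compatible_in P r p q" if "p \<in> B" "q \<in> B" "p \<noteq> q" for p q
    proof -
      have "f p \<noteq> f q" using f that B by (auto simp: inj_on_def)
      then show ?thesis using anti compat[of p q] that B by blast
    qed
    then have "countable B" using ccc B RP unfolding ccc_def by (meson order_trans)
    then show "countable A" using B by simp
  qed
  moreover have "\<forall>E \<in> (\<lambda>D. f ` (D \<inter> R)) ` \<D>. dense_in_poset (f ` R) s E"
  proof clarify
    fix D assume D: "D \<in> \<D>"
    have "\<exists>d \<in> f ` (D \<inter> R). (d, f p) \<in> s" if "p \<in> R" for p
      using e[of D p] Re[of D p] D that RP s by blast
    then show "dense_in_poset (f ` R) s (f ` (D \<inter> R))"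
      by (auto simp: dense_in_poset_def)
  qed
  moreover have "(\<lambda>D. f ` (D \<inter> R)) ` \<D> \<prec> (UNIV :: real set)"
    using image_lepoll small lesspoll_trans1 by blast
  ultimately obtain G where G: "poset_filter (f ` R) s G"
      and meet: "\<forall>E \<in> (\<lambda>D. f ` (D \<inter> R)) ` \<D>. G \<inter> E \<noteq> {}"
    using assms unfolding martin_axiom_def martin_axiom_on_def by metis
  define H where "H = {p \<in> P. \<exists>q\<in>R. f q \<in> G \<and> (q, p) \<in> r}"
  have GR: "\<exists>q\<in>R. x = f q" if "x \<in> G" for x using G that by (auto simp: poset_filter_def)
  have inH: "q \<in> H" if "q \<in> R" "f q \<in> G" for q
    using that RP rfl by (auto simp: H_def)
  have "poset_filter P r H"
    unfolding poset_filter_def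
  proof (intro conjI ballI impI)
    show "H \<subseteq> P" by (auto simp: H_def)
    obtain x where "x \<in> G" using G by (auto simp: poset_filter_def)
    then show "H \<noteq> {}" using GR inH by blast
  next
    fix p q assume "p \<in> H" "q \<in> P" "(p, q) \<in> r"
    then show "q \<in> H" using trn by (auto simp: H_def)
  next
    fix p q assume "p \<in> H" "q \<in> H"
    then obtain a b where ab: "a \<in> R" "b \<in> R" "f a \<in> G" "f b \<in> G" "(a, p) \<in> r" "(b, q) \<in> r"
      by (auto simp: H_def)
    then obtain z where z: "z \<in> G" "(z, f a) \<in> s" "(z, f b) \<in> s"
      using G unfolding poset_filter_def by metis
    then obtain c where "c \<in> R" "z = f c" using GR by blast
    then show "\<exists>c\<in>H. (c, p) \<in> r \<and> (c, q) \<in> r"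
      using z ab s inH trn by blast
  qed
  moreover have "H \<inter> D \<noteq> {}" if "D \<in> \<D>" for D
    using meet inH that by blast
  ultimately show "\<exists>G. poset_filter P r G \<and> (\<forall>D\<in>\<D>. G \<inter> D \<noteq> {})" by blast
qed


section \<open>Ultrafilters\<close>

text \<open>The order on the library type of filters is reverse inclusion of the families of sets, and
  \<open>bot\<close> is the improper filter. So a maximal proper filter is a minimal element
  different from \<open>bot\<close>, and \<open>F \<le> cofinite\<close> says that \<open>F\<close> contains all cofinite sets.\<close>

definition ultrafilter :: "'i filter \<Rightarrow> bool" where
  "ultrafilter F \<longleftrightarrow> F \<noteq> bot \<and> (\<forall>G. G \<noteq> bot \<and> G \<le> F \<longrightarrow> G = F)"

definition free_filter :: "'i filter \<Rightarrow> bool" where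
  "free_filter F \<longleftrightarrow> F \<le> cofinite"


section \<open>Topological vector spaces\<close>

definition scalar_field :: "'k::field ring" where
  "scalar_field = \<lparr>carrier = UNIV, mult = (*), one = 1, zero = 0, add = (+)\<rparr>"

text \<open>A module record also has (unused) fields \<open>mult\<close> and \<open>one\<close>,
  on which nothing is assumed. The carrier is an arbitrary set of elements of type \<open>'v\<close>,
  with operations and topology unrelated to any structure on \<open>'v\<close>; fixing \<open>'v\<close> in an
  existence statement therefore only bounds the cardinality of the space.\<close>

locale hausdorff_tvs = Module.module scalar_field X
  for X :: "('k::real_normed_field, 'v) module" (structure) +
  fixes T :: "'v topology"
  assumes topspace_eq: "topspace T = carrier X"
    and hausdorff: "Hausdorff_space T"
    and continuous_add: "continuous_map (prod_topology T T) T (\<lambda>(x, y). x \<oplus> y)"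
    and continuous_smult: "continuous_map (prod_topology euclidean T) T (\<lambda>(a, x). a \<odot> x)"

definition Cauchy_over ::
    "('k, 'v) module \<Rightarrow> 'v topology \<Rightarrow> nat filter \<Rightarrow> (nat \<Rightarrow> 'v) \<Rightarrow> bool" where
  "Cauchy_over X T F x \<longleftrightarrow>
     (\<forall>U. openin T U \<and> \<zero>\<^bsub>X\<^esub> \<in> U \<longrightarrow>
        (\<exists>B. eventually (\<lambda>n. n \<in> B) F \<and> (\<forall>n\<in>B. \<forall>m\<in>B. x n \<ominus>\<^bsub>X\<^esub> x m \<in> U)))"

definition Compl :: "nat filter \<Rightarrow> ('k, 'v) module \<Rightarrow> 'v topology \<Rightarrow> bool" where
  "Compl F X T \<longleftrightarrow>
     (\<forall>x. range x \<subseteq> carrier X \<and> Cauchy_over X T F x \<longrightarrow> (\<exists>y\<in>carrier X. limitin T x y F))"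

end

theory Submission
  imports Defs
begin

text \<open>
  The separation rests on a comparison of cardinalities. Let \<open>K\<close> be the scalar field and view
  \<open>n\<close> as its point mass, the function on \<open>Pow \<nat>\<close> that sends \<open>A\<close> to 1 if \<open>n \<in> A\<close> and to 0
  otherwise. In the space of all functions from \<open>Pow \<nat>\<close> to \<open>K\<close>, with pointwise convergence, the
  sequence of point masses converges over every ultrafilter \<open>U\<close>, and its limit is the characteristic
  function of \<open>U\<close> (\<open>point_mass_tendsto\<close>). Hence different ultrafilters give this single
  sequence different limits.

  Fix any free ultrafilter \<open>U1\<close>, and close the point masses under linear combinations and under
  limits of sequences over \<open>U1\<close>. The resulting space \<open>V\<close> is complete over \<open>U1\<close>: a Cauchy
  sequence over \<open>U1\<close> is Cauchy in each coordinate, so its pointwise limit exists, and \<open>V\<close> contains it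
  (\<open>Compl_if_closed_under_Lim\<close>). Each element of \<open>V\<close> is the value of a well-founded expression
  built with operations of countable arity from continuum many data, so \<open>V\<close> has at most continuum
  many elements (\<open>expr_lepoll_nat_sets\<close>). But an independent family of continuum many subsets of
  \<open>\<nat>\<close> yields as many ultrafilters as there are sets of subsets of \<open>\<nat>\<close>
  (\<open>many_ultrafilters\<close>), so the characteristic function of some \<open>U2\<close> lies outside \<open>V\<close>. Over
  this \<open>U2\<close> the point masses form a Cauchy sequence without a limit in \<open>V\<close>. Finally \<open>U2\<close> is
  free, since the characteristic function of a principal ultrafilter is itself a point mass.
\<close>

section \<open>Existence of ultrafilters\<close>

lemma ultrafilter_cases:
  assumes "ultrafilter U"
  shows "eventually P U \<or> eventually (\<lambda>x. \<not> P x) U"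
proof (cases "inf U (principal {x. P x}) = bot")
  case True
  then have "eventually (\<lambda>x. \<not> P x) U"
    by (simp add: trivial_limit_def eventually_inf_principal)
  then show ?thesis ..
next
  case False
  moreover have "inf U (principal {x. P x}) \<le> U" by simp
  ultimately have "inf U (principal {x. P x}) = U"
    using assms unfolding ultrafilter_def by blast
  then have "U \<le> principal {x. P x}" by (metis inf_le2)
  then show ?thesis by (simp add: le_principal)
qed

text \<open>The ultrafilter theorem, by Zorn's lemma: a chain of proper filters is a base of its infimum, so
  the infimum cannot contain the empty set.\<close>

lemma ultrafilter_below:
  assumes "F \<noteq> bot"
  shows "\<exists>U\<le>F. ultrafilter U"
proof -
  define A where "A = {G. G \<noteq> bot \<and> G \<le> F}"
  have po: "partial_order_on A (relation_of (\<ge>) A)"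
    by (rule partial_order_on_relation_ofI) auto
  have "\<exists>u\<in>A. \<forall>a\<in>C. u \<le> a" if C: "C \<in> Chains (relation_of (\<ge>) A)" for C
  proof (cases "C = {}")
    case True
    then show ?thesis using assms by (auto simp: A_def)
  next
    case False
    have CA: "C \<subseteq> A" and tot: "\<And>a b. a \<in> C \<Longrightarrow> b \<in> C \<Longrightarrow> a \<le> b \<or> b \<le> a"
      using C by (auto simp: Chains_def relation_of_def)
    have "Inf C \<noteq> bot"
    proof
      assume "Inf C = bot"
      then have "eventually (\<lambda>_. False) (Inf C)" by simp
      moreover have "\<exists>x\<in>C. x \<le> inf G H" if "G \<in> C" "H \<in> C" for G H
        using tot[OF that] that by (auto intro: bexI[of _ G] bexI[of _ H])
      ultimately obtain b where "b \<in> C" "eventually (\<lambda>_. False) b"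
        using eventually_Inf_base[OF False] by blast
      then show False using CA by (auto simp: A_def trivial_limit_def)
    qed
    moreover have "Inf C \<le> F" using False CA by (auto simp: A_def intro: Inf_lower2)
    ultimately show ?thesis by (auto simp: A_def intro: Inf_lower)
  qed
  from predicate_Zorn[OF po this] obtain U where "U \<in> A" "\<forall>a\<in>A. a \<le> U \<longrightarrow> a = U"
    by blast
  then have "ultrafilter U" by (auto simp: A_def ultrafilter_def intro: order_trans)
  with \<open>U \<in> A\<close> show ?thesis by (auto simp: A_def)
qed

lemma free_ultrafilter_exists:
  assumes "infinite (UNIV :: 'i set)"
  shows "\<exists>U :: 'i filter. ultrafilter U \<and> free_filter U"
proof -
  have "(cofinite :: 'i filter) \<noteq> bot" using assms by (simp add: cofinite_bot)
  from ultrafilter_below[OF this] show ?thesis by (auto simp: free_filter_def)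
qed

text \<open>A cofinite set is a finite intersection of complements of points.\<close>

lemma free_filterI:
  assumes "\<And>n. eventually (\<lambda>x. x \<noteq> n) U"
  shows "free_filter U"
  unfolding free_filter_def
proof (rule filter_leI)
  fix P :: "'a \<Rightarrow> bool" assume "eventually P cofinite"
  then have "eventually (\<lambda>x. \<forall>n\<in>{x. \<not> P x}. x \<noteq> n) U"
    using assms by (intro eventually_ball_finite) (auto simp: eventually_cofinite)
  then show "eventually P U" by (rule eventually_mono) auto
qed


section \<open>More than continuum many ultrafilters\<close>

text \<open>This is the Fichtenholz--Kantorovich independent family, indexed by all subsets of \<open>\<nat>\<close>. A
  number codes a length \<open>k\<close> and a finite collection \<open>L\<close> of bit strings, and it is put into the set
  of \<open>A\<close> if \<open>L\<close> contains the first \<open>k\<close> bits of \<open>A\<close>. Lists stand for the finite collections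
  because their type is countable.\<close>

definition independent_set :: "nat set \<Rightarrow> nat set" where
  "independent_set A =
     {n. case from_nat n of (k, L :: bool list list) \<Rightarrow> map (\<lambda>i. i \<in> A) [0..<k] \<in> set L}"

text \<open>Finitely many sets \<open>A\<close> already differ on their first \<open>k\<close> bits for some \<open>k\<close>. The number that
  codes \<open>k\<close> and the prefixes of those that lie in \<open>\<A>\<close> is then in the intersection.\<close>

lemma independent_set_finite_intersection:
  assumes "finite \<B>"
  shows "(\<Inter>A\<in>\<B>. if A \<in> \<A> then independent_set A else - independent_set A) \<noteq> {}"
proof -
  \<comment> \<open>a bit in which two different sets differ\<close>
  define d where "d = (\<lambda>(A :: nat set, B). SOME i. (i \<in> A) \<noteq> (i \<in> B))"
  define pre where "pre = (\<lambda>k A. map (\<lambda>i. i \<in> A) [0..<k] :: bool list)"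
  have "finite (d ` (\<B> \<times> \<B>))" using assms by simp
  then obtain k where k: "\<And>i. i \<in> d ` (\<B> \<times> \<B>) \<Longrightarrow> i < k"
    using finite_nat_set_iff_bounded[of "d ` (\<B> \<times> \<B>)"] by blast
  have inj: "A = B" if "A \<in> \<B>" "B \<in> \<B>" "pre k A = pre k B" for A B
  proof (rule ccontr)
    assume "A \<noteq> B"
    then have "\<exists>i. (i \<in> A) \<noteq> (i \<in> B)" by blast
    from someI_ex[OF this] have "(d (A, B) \<in> A) \<noteq> (d (A, B) \<in> B)" by (simp add: d_def)
    moreover have "d (A, B) < k" using k that by blast
    ultimately show False using that(3) by (auto simp: pre_def)
  qed
  obtain L where L: "set L = pre k ` (\<B> \<inter> \<A>)"
    using finite_list[of "pre k ` (\<B> \<inter> \<A>)"] assms by auto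
  have "to_nat (k, L) \<in> (if A \<in> \<A> then independent_set A else - independent_set A)"
    if "A \<in> \<B>" for A
  proof -
    have "to_nat (k, L) \<in> independent_set A \<longleftrightarrow> pre k A \<in> set L"
      by (simp add: independent_set_def pre_def)
    also have "\<dots> \<longleftrightarrow> A \<in> \<A>" using inj that L by blast
    finally show ?thesis by simp
  qed
  then show ?thesis by blast
qed

text \<open>Independence lets any set \<open>\<A>\<close> of indices prescribe which members of the family an
  ultrafilter contains, and \<open>\<A>\<close> can be read off from the ultrafilter.\<close>

lemma many_ultrafilters:
  "\<exists>W :: nat set set \<Rightarrow> nat filter. inj W \<and> (\<forall>\<A>. ultrafilter (W \<A>))"
proof -
  define b where "b = (\<lambda>\<A> A. if A \<in> \<A> then independent_set A else - independent_set A)"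
  have "\<exists>U. ultrafilter U \<and> (\<forall>A. eventually (\<lambda>n. n \<in> b \<A> A) U)" for \<A>
  proof -
    have "(INF A. principal (b \<A> A)) \<noteq> bot"
    proof (rule INF_filter_not_bot)
      fix \<B> :: "nat set set" assume "finite \<B>"
      then show "(INF A\<in>\<B>. principal (b \<A> A)) \<noteq> bot"
        using independent_set_finite_intersection[of \<B> \<A>]
        by (simp add: INF_principal_finite principal_eq_bot_iff b_def)
    qed
    then obtain U where U: "U \<le> (INF A. principal (b \<A> A))" "ultrafilter U"
      using ultrafilter_below by blast
    then have "U \<le> principal (b \<A> A)" for A by (simp add: le_INF_iff)
    then show ?thesis using U by (auto simp: le_principal)
  qed
  then obtain W where W: "\<And>\<A>. ultrafilter (W \<A>)"
      and ev: "\<And>\<A> A. eventually (\<lambda>n. n \<in> b \<A> A) (W \<A>)"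
    by metis
  have sub: "\<A> \<subseteq> \<A>'" if "W \<A> = W \<A>'" for \<A> \<A>'
  proof (rule ccontr)
    assume "\<not> \<A> \<subseteq> \<A>'"
    then obtain A where "A \<in> \<A>" "A \<notin> \<A>'" by blast
    then have "eventually (\<lambda>n. n \<in> independent_set A) (W \<A>)"
      "eventually (\<lambda>n. n \<notin> independent_set A) (W \<A>)"
      using ev[where \<A> = \<A> and A = A] ev[where \<A> = \<A>' and A = A] that by (auto simp: b_def)
    then have "eventually (\<lambda>_. False) (W \<A>)" by eventually_elim simp
    then show False using W by (auto simp: ultrafilter_def trivial_limit_def)
  qed
  have "inj W" by (rule injI) (metis sub subset_antisym)
  with W show ?thesis by blast
qed


section \<open>Closing under limits of sequences\<close>

text \<open>An expression records how an element of the closure arises, as a well-founded tree with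
  countable branching. Counting expressions replaces the transfinite iteration, of length
  \<open>\<omega>\<^sub>1\<close>, that builds the closure from below.\<close>

datatype 'k expr =
  Generator nat
| Combination 'k "'k expr" "'k expr"
| Limit "nat \<Rightarrow> 'k expr"

text \<open>If a sequence has no limit over \<open>F\<close> at some \<open>a\<close>, then \<open>Lim\<close> is an unspecified scalar there.
  This may enlarge the closure, but completeness over \<open>F\<close> and the bound on the cardinality
  hold for the larger space as well.\<close>

primrec expr_value ::
    "nat filter \<Rightarrow> (nat \<Rightarrow> 'a \<Rightarrow> 'k::real_normed_field) \<Rightarrow> 'k expr \<Rightarrow> 'a \<Rightarrow> 'k" where
  "expr_value F g (Generator n) = g n"
| "expr_value F g (Combination c s t) = (\<lambda>a. expr_value F g s a + c * expr_value F g t a)"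
| "expr_value F g (Limit f) = (\<lambda>a. Lim F (\<lambda>n. expr_value F g (f n) a))"

text \<open>A tree is determined by the map that assigns to each path from the root the label found there.
  The second component tells the constructors apart: 0 and 1 mark limits and combinations, and
  \<open>n + 2\<close> marks the generator \<open>n\<close>. Beyond a leaf the label is just repeated.\<close>

primrec expr_code :: "'k::zero expr \<Rightarrow> nat list \<Rightarrow> 'k \<times> nat" where
  "expr_code (Generator n) = (\<lambda>_. (0, n + 2))"
| "expr_code (Combination c s t) =
     (\<lambda>p. case p of [] \<Rightarrow> (c, 1) | i # q \<Rightarrow> if i = 0 then expr_code s q else expr_code t q)"
| "expr_code (Limit f) = (\<lambda>p. case p of [] \<Rightarrow> (0, 0) | i # q \<Rightarrow> expr_code (f i) q)"

lemma expr_code_eqD: "expr_code s = expr_code t \<Longrightarrow> s = t"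
proof (induction s arbitrary: t)
  case (Generator n)
  from fun_cong[OF Generator, of "[]"] show ?case by (cases t) auto
next
  case (Combination c s1 s2)
  from fun_cong[OF Combination.prems, of "[]"] obtain t1 t2 where t: "t = Combination c t1 t2"
    by (cases t) auto
  have "expr_code s1 q = expr_code t1 q" "expr_code s2 q = expr_code t2 q" for q
    using fun_cong[OF Combination.prems, of "0 # q"] fun_cong[OF Combination.prems, of "1 # q"]
    by (simp_all add: t)
  then show ?case using Combination.IH t by blast
next
  case (Limit f)
  from fun_cong[OF Limit.prems, of "[]"] obtain h where t: "t = Limit h"
    by (cases t) auto
  have "expr_code (f i) q = expr_code (h i) q" for i q
    using fun_cong[OF Limit.prems, of "i # q"] by (simp add: t)
  then show ?case using Limit.IH t by blast
qed

text \<open>With the values coded by sets of numbers, a function becomes a subset of a countable product,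
  which is the reason for \<open>c ^ \<omega> = c\<close>, where \<open>c\<close> is the cardinality of the continuum.\<close>

lemma countable_fun_lepoll_nat_sets:
  assumes "(UNIV :: 'b set) \<lesssim> (UNIV :: nat set set)"
  shows "(UNIV :: ('a::countable \<Rightarrow> 'b) set) \<lesssim> (UNIV :: nat set set)"
proof -
  obtain g :: "'b \<Rightarrow> nat set" where g: "inj g" using assms by (auto simp: lepoll_def)
  define h :: "('a \<Rightarrow> 'b) \<Rightarrow> nat set" where "h f = to_nat ` {(a, m). m \<in> g (f a)}" for f
  have "inj h"
  proof (rule injI)
    fix f f' assume "h f = h f'"
    then have "{(a, m). m \<in> g (f a)} = {(a, m). m \<in> g (f' a)}"
      by (simp add: h_def inj_image_eq_iff)
    then have "g (f a) = g (f' a)" for a by (auto simp: set_eq_iff)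
    then show "f = f'" using g by (auto simp: inj_def)
  qed
  then show ?thesis by (auto simp: lepoll_def)
qed

lemma expr_lepoll_nat_sets:
  assumes "(UNIV :: 'k::zero set) \<lesssim> (UNIV :: nat set set)"
  shows "(UNIV :: 'k expr set) \<lesssim> (UNIV :: nat set set)"
proof -
  have "infinite (UNIV :: nat set set)" by (simp add: Finite_Set.finite_set)
  moreover have "(UNIV :: nat set) \<lesssim> (UNIV :: nat set set)"
    by (auto simp: lepoll_def intro!: exI[of _ "\<lambda>n. {n}"] injI)
  ultimately have "(UNIV :: ('k \<times> nat) set) \<lesssim> (UNIV :: nat set set)"
    using Times_lepoll_infinite[OF assms] by (metis UNIV_Times_UNIV)
  then have "(UNIV :: (nat list \<Rightarrow> 'k \<times> nat) set) \<lesssim> (UNIV :: nat set set)"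
    by (rule countable_fun_lepoll_nat_sets)
  moreover have "(UNIV :: 'k expr set) \<lesssim> (UNIV :: (nat list \<Rightarrow> 'k \<times> nat) set)"
    by (auto simp: lepoll_def intro!: exI[of _ expr_code] injI dest: expr_code_eqD)
  ultimately show ?thesis using lepoll_trans by blast
qed


section \<open>Spaces of functions with pointwise convergence\<close>

text \<open>The multiplication and unit fields have to be filled in because a module record extends a ring
  record; the pointwise ones are the natural choice.\<close>

definition function_module :: "('a \<Rightarrow> 'k::field) set \<Rightarrow> ('k, 'a \<Rightarrow> 'k) module" where
  "function_module V =
     \<lparr>carrier = V, mult = (\<lambda>f g a. f a * g a), one = (\<lambda>_. 1), zero = (\<lambda>_. 0),
      add = (\<lambda>f g a. f a + g a), smult = (\<lambda>c f a. c * f a)\<rparr>"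

lemma carrier_function_module [simp]: "carrier (function_module V) = V"
  by (simp add: function_module_def)

lemma tendsto_fun_iff:
  fixes f :: "'n \<Rightarrow> 'a \<Rightarrow> 'b::topological_space"
  shows "(f \<longlongrightarrow> y) F \<longleftrightarrow> (\<forall>a. ((\<lambda>n. f n a) \<longlongrightarrow> y a) F)"
  using limitin_componentwise[of "\<lambda>_. euclidean :: 'b topology" UNIV f y F]
  by (simp add: euclidean_product_topology)

locale function_subspace =
  fixes V :: "('a \<Rightarrow> 'k::real_normed_field) set"
  assumes nonempty: "V \<noteq> {}"
    and combination: "\<And>c f g. f \<in> V \<Longrightarrow> g \<in> V \<Longrightarrow> (\<lambda>a. f a + c * g a) \<in> V"
begin

lemma zero: "(\<lambda>_. 0) \<in> V"
proof -
  obtain f where "f \<in> V" using nonempty by blast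
  from combination[OF this this, of "- 1"] show ?thesis by simp
qed

lemma add: "f \<in> V \<Longrightarrow> g \<in> V \<Longrightarrow> (\<lambda>a. f a + g a) \<in> V"
  using combination[of f g 1] by simp

lemma smult: "f \<in> V \<Longrightarrow> (\<lambda>a. c * f a) \<in> V"
  using combination[OF zero, of f c] by simp

lemma abelian_group: "abelian_group (function_module V)"
proof (rule abelian_groupI)
  fix f assume "f \<in> carrier (function_module V)"
  then show "\<exists>g\<in>carrier (function_module V).
      g \<oplus>\<^bsub>function_module V\<^esub> f = \<zero>\<^bsub>function_module V\<^esub>"
    using smult[of f "- 1"] by (intro bexI[of _ "\<lambda>a. - 1 * f a"]) (auto simp: function_module_def)
qed (auto simp: function_module_def zero add add_ac)

lemma minus:
  assumes "f \<in> V" "g \<in> V"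
  shows "f \<ominus>\<^bsub>function_module V\<^esub> g = (\<lambda>a. f a - g a)"
proof -
  interpret abelian_group "function_module V" by (rule abelian_group)
  have "\<ominus>\<^bsub>function_module V\<^esub> g = (\<lambda>a. - 1 * g a)"
    using assms smult[of g "- 1"] by (intro minus_equality) (auto simp: function_module_def)
  then show ?thesis by (simp add: a_minus_def function_module_def)
qed

lemma module: "Module.module scalar_field (function_module V)"
proof (rule moduleI)
  show "cring (scalar_field :: 'k ring)"
  proof (rule cringI)
    show "abelian_group (scalar_field :: 'k ring)"
    proof (rule abelian_groupI)
      fix x :: 'k
      show "\<exists>y\<in>carrier scalar_field. y \<oplus>\<^bsub>scalar_field\<^esub> x = \<zero>\<^bsub>scalar_field\<^esub>"
        by (rule bexI[of _ "- x"]) (auto simp: scalar_field_def)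
    qed (auto simp: scalar_field_def add_ac)
    show "comm_monoid (scalar_field :: 'k ring)"
      by (rule comm_monoidI) (auto simp: scalar_field_def mult_ac)
  qed (auto simp: scalar_field_def distrib_right)
qed (use smult abelian_group in
  \<open>auto simp: function_module_def scalar_field_def distrib_left distrib_right mult_ac\<close>)

lemma hausdorff_tvs: "hausdorff_tvs (function_module V) (top_of_set V)"
proof -
  interpret Module.module scalar_field "function_module V" by (rule module)
  show ?thesis
  proof
    show "topspace (top_of_set V) = carrier (function_module V)"
      by (simp add: function_module_def)
    show "Hausdorff_space (top_of_set V)"
      by (intro Hausdorff_space_subtopology)
        (simp add: Hausdorff_space_product_topology flip: euclidean_product_topology)
    have snd: "continuous_on S (\<lambda>x. snd x a)" for S :: "('b::topological_space \<times> ('a \<Rightarrow> 'k)) set" and a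
      by (rule continuous_on_product_then_coordinatewise[OF continuous_on_snd[OF continuous_on_id]])
    have "continuous_on (V \<times> V) (\<lambda>x. fst x a + snd x a)" for a
      by (rule continuous_on_add[OF continuous_on_product_then_coordinatewise[
            OF continuous_on_fst[OF continuous_on_id]] snd])
    then have "continuous_on (V \<times> V) (\<lambda>x a. fst x a + snd x a)"
      by (rule continuous_on_coordinatewise_then_product)
    then show "continuous_map (prod_topology (top_of_set V) (top_of_set V)) (top_of_set V)
        (\<lambda>(x, y). x \<oplus>\<^bsub>function_module V\<^esub> y)"
      by (auto simp: case_prod_unfold function_module_def continuous_map_in_subtopology add
          image_subset_iff)
    have "continuous_on (UNIV \<times> V) (\<lambda>x. fst x * snd x a)" for a
      by (rule continuous_on_mult[OF continuous_on_fst[OF continuous_on_id] snd])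
    then have "continuous_on (UNIV \<times> V) (\<lambda>x a. fst x * snd x a)"
      by (rule continuous_on_coordinatewise_then_product)
    then have "continuous_map (top_of_set (UNIV \<times> V)) (top_of_set V) (\<lambda>x a. fst x * snd x a)"
      by (auto simp: continuous_map_in_subtopology smult image_subset_iff)
    then show "continuous_map (prod_topology euclidean (top_of_set V)) (top_of_set V)
        (\<lambda>(c, x). c \<odot>\<^bsub>function_module V\<^esub> x)"
      using prod_topology_subtopology_eu[of "UNIV :: 'k set" V]
      by (simp add: case_prod_unfold function_module_def)
  qed
qed

lemma limitin_iff:
  assumes "range x \<subseteq> V" "y \<in> V"
  shows "limitin (top_of_set V) x y F \<longleftrightarrow> (\<forall>a. ((\<lambda>n. x n a) \<longlongrightarrow> y a) F)"
  using assms by (auto simp: limitin_subtopology image_subset_iff tendsto_fun_iff)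

text \<open>The condition that one coordinate is small defines a neighbourhood of zero.\<close>

lemma Cauchy_over_coordinate:
  assumes cau: "Cauchy_over (function_module V) (top_of_set V) F x" and x: "range x \<subseteq> V"
  shows "cauchy_filter (filtermap (\<lambda>n. x n a) F)"
  unfolding cauchy_filter_metric_filtermap
proof (intro allI impI)
  fix e :: real assume e: "e > 0"
  define U where "U = V \<inter> (\<lambda>f. f a) -` ball 0 e"
  have "open ((\<lambda>f :: 'a \<Rightarrow> 'k. f a) -` ball 0 e)"
    by (rule open_vimage) simp_all
  then have "openin (top_of_set V) U" unfolding U_def by (rule openin_open_Int)
  moreover have "\<zero>\<^bsub>function_module V\<^esub> \<in> U"
    using e zero by (simp add: U_def function_module_def)
  ultimately obtain B where "eventually (\<lambda>n. n \<in> B) F"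
    and "\<forall>n\<in>B. \<forall>m\<in>B. x n \<ominus>\<^bsub>function_module V\<^esub> x m \<in> U"
    using cau unfolding Cauchy_over_def by blast
  then show "\<exists>P. eventually P F \<and> (\<forall>n m. P n \<and> P m \<longrightarrow> dist (x n a) (x m a) < e)"
    using x by (intro exI[of _ "\<lambda>n. n \<in> B"])
      (auto simp: minus U_def dist_norm norm_minus_commute image_subset_iff)
qed

text \<open>The limit \<open>y\<close> may lie outside \<open>V\<close>. By continuity of subtraction, the differences tend to zero
  over the product filter \<open>F \<times>\<^sub>F F\<close>, in the space of all functions.\<close>

lemma pointwise_convergent_imp_Cauchy_over:
  assumes lim: "\<And>a. ((\<lambda>n. x n a) \<longlongrightarrow> y a) F" and x: "range x \<subseteq> V"
  shows "Cauchy_over (function_module V) (top_of_set V) F x"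
  unfolding Cauchy_over_def
proof (intro allI impI, elim conjE)
  fix U assume "openin (top_of_set V) U" and zU: "\<zero>\<^bsub>function_module V\<^esub> \<in> U"
  then obtain W where W: "open W" "U = V \<inter> W" by (auto simp: openin_open)
  have "((\<lambda>p. x (fst p) a - x (snd p) a) \<longlongrightarrow> y a - y a) (F \<times>\<^sub>F F)" for a
    by (intro tendsto_diff filterlim_compose[OF lim filterlim_fst]
        filterlim_compose[OF lim filterlim_snd])
  then have "((\<lambda>p a. x (fst p) a - x (snd p) a) \<longlongrightarrow> (\<lambda>_. 0)) (F \<times>\<^sub>F F)"
    by (simp add: tendsto_fun_iff)
  moreover have "(\<lambda>_. 0) \<in> W" using zU W by (simp add: function_module_def)
  ultimately have "eventually (\<lambda>p. (\<lambda>a. x (fst p) a - x (snd p) a) \<in> W) (F \<times>\<^sub>F F)"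
    using W by (auto dest: topological_tendstoD)
  then obtain Q where Q: "eventually Q F"
    and QW: "\<And>n m. Q n \<Longrightarrow> Q m \<Longrightarrow> (\<lambda>a. x n a - x m a) \<in> W"
    by (auto simp: eventually_prod_same)
  have "x n \<ominus>\<^bsub>function_module V\<^esub> x m \<in> U" if "Q n" "Q m" for n m
  proof -
    have V: "x n \<in> V" "x m \<in> V" using x by auto
    then have "(\<lambda>a. x n a + - 1 * x m a) \<in> V" by (rule combination)
    then show ?thesis using QW[OF that] V by (simp add: minus W)
  qed
  then show "\<exists>B. eventually (\<lambda>n. n \<in> B) F \<and>
      (\<forall>n\<in>B. \<forall>m\<in>B. x n \<ominus>\<^bsub>function_module V\<^esub> x m \<in> U)"
    using Q by (intro exI[of _ "Collect Q"]) auto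
qed

end

text \<open>Completeness of the scalars makes every coordinate of a Cauchy sequence converge, so that
  \<open>Lim\<close> is a genuine limit here.\<close>

lemma Compl_if_closed_under_Lim:
  fixes V :: "('a \<Rightarrow> 'k::{real_normed_field,banach}) set"
  assumes "function_subspace V" and F: "F \<noteq> bot"
    and closed: "\<And>x. range x \<subseteq> V \<Longrightarrow> (\<lambda>a. Lim F (\<lambda>n. x n a)) \<in> V"
  shows "Compl F (function_module V) (top_of_set V)"
proof -
  interpret function_subspace V by fact
  have "\<exists>y\<in>V. limitin (top_of_set V) x y F"
    if x: "range x \<subseteq> V" and cau: "Cauchy_over (function_module V) (top_of_set V) F x" for x
  proof (rule bexI)
    show lim: "(\<lambda>a. Lim F (\<lambda>n. x n a)) \<in> V" using closed x .
    have "((\<lambda>n. x n a) \<longlongrightarrow> Lim F (\<lambda>n. x n a)) F" for a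
    proof -
      have "\<exists>l. filtermap (\<lambda>n. x n a) F \<le> nhds l"
        using cauchy_filter_complete_converges[OF Cauchy_over_coordinate[OF cau x, of a] complete_UNIV] F
        by (auto simp: filtermap_bot_iff)
      then obtain l where "((\<lambda>n. x n a) \<longlongrightarrow> l) F" by (auto simp: filterlim_def)
      moreover from tendsto_Lim[OF F this] have "Lim F (\<lambda>n. x n a) = l" .
      ultimately show ?thesis by simp
    qed
    then show "limitin (top_of_set V) x (\<lambda>a. Lim F (\<lambda>n. x n a)) F"
      using limitin_iff[OF x lim] by blast
  qed
  then show ?thesis unfolding Compl_def carrier_function_module by blast
qed


section \<open>Separating two ultrafilters\<close>

definition point_mass :: "nat \<Rightarrow> nat set \<Rightarrow> 'k::real_normed_field" where
  "point_mass n A = of_bool (n \<in> A)"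

definition ultrafilter_mass :: "nat filter \<Rightarrow> nat set \<Rightarrow> 'k::real_normed_field" where
  "ultrafilter_mass U A = of_bool (eventually (\<lambda>n. n \<in> A) U)"

lemma point_mass_tendsto:
  assumes "ultrafilter U"
  shows "((\<lambda>n. point_mass n A) \<longlongrightarrow> ultrafilter_mass U A) U"
proof -
  have "eventually (\<lambda>n. point_mass n A = (ultrafilter_mass U A :: 'a)) U"
  proof (cases "eventually (\<lambda>n. n \<in> A) U")
    case True
    then show ?thesis by eventually_elim (simp add: point_mass_def ultrafilter_mass_def True)
  next
    case False
    then have "eventually (\<lambda>n. n \<notin> A) U" using ultrafilter_cases[OF assms] by blast
    then show ?thesis by eventually_elim (simp add: point_mass_def ultrafilter_mass_def False)
  qed
  then show ?thesis by (rule tendsto_eventually)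
qed

lemma filter_eqI_Collect:
  assumes "\<And>A. eventually (\<lambda>x. x \<in> A) F = eventually (\<lambda>x. x \<in> A) G"
  shows "F = G"
proof (rule filter_eqI)
  show "eventually P F = eventually P G" for P using assms[of "Collect P"] by simp
qed

lemma ultrafilter_mass_inject:
  assumes "ultrafilter_mass U = (ultrafilter_mass U' :: _ \<Rightarrow> 'k::real_normed_field)"
  shows "U = U'"
proof (rule filter_eqI_Collect)
  fix A
  show "eventually (\<lambda>n. n \<in> A) U = eventually (\<lambda>n. n \<in> A) U'"
    using fun_cong[OF assms, of A] by (simp add: ultrafilter_mass_def of_bool_def split: if_splits)
qed

text \<open>The cardinality argument, for any complete scalar field of at most continuum many elements.\<close>

lemma separating_tvs:
  assumes small: "(UNIV :: 'k::{real_normed_field,banach} set) \<lesssim> (UNIV :: nat set set)"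
  shows "\<exists>(U1 :: nat filter) (U2 :: nat filter) (X :: ('k, nat set \<Rightarrow> 'k) module) T.
    ultrafilter U1 \<and> free_filter U1 \<and> ultrafilter U2 \<and> free_filter U2 \<and>
    hausdorff_tvs X T \<and> Compl U1 X T \<and> \<not> Compl U2 X T"
proof -
  obtain U1 :: "nat filter" where U1: "ultrafilter U1" "free_filter U1"
    using free_ultrafilter_exists[OF infinite_UNIV_nat] by blast
  define val where "val = (expr_value U1 point_mass :: 'k expr \<Rightarrow> nat set \<Rightarrow> 'k)"
  define V where "V = range val"
  interpret V: function_subspace V
  proof
    show "V \<noteq> {}" by (simp add: V_def)
    fix c f g assume "f \<in> V" "g \<in> V"
    then obtain s t where "f = val s" "g = val t" by (auto simp: V_def)
    then have "(\<lambda>a. f a + c * g a) = val (Combination c s t)" by (simp add: val_def)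
    then show "(\<lambda>a. f a + c * g a) \<in> V" by (simp add: V_def)
  qed
  have compl: "Compl U1 (function_module V) (top_of_set V)"
  proof (rule Compl_if_closed_under_Lim)
    show "U1 \<noteq> bot" using U1 by (simp add: ultrafilter_def)
    fix x :: "nat \<Rightarrow> nat set \<Rightarrow> 'k" assume "range x \<subseteq> V"
    then have "\<forall>n. \<exists>t. x n = val t" by (auto simp: V_def)
    then obtain t where "\<And>n. x n = val (t n)" by metis
    then have "(\<lambda>a. Lim U1 (\<lambda>n. x n a)) = val (Limit t)" by (simp add: val_def)
    then show "(\<lambda>a. Lim U1 (\<lambda>n. x n a)) \<in> V" by (simp add: V_def)
  qed (rule V.function_subspace_axioms)
  have pm: "point_mass n \<in> V" for n
  proof -
    have "point_mass n = val (Generator n)" by (simp add: val_def)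
    then show ?thesis by (simp add: V_def)
  qed
  obtain W :: "nat set set \<Rightarrow> nat filter" where W: "inj W" "\<And>\<A>. ultrafilter (W \<A>)"
    using many_ultrafilters by blast
  \<comment> \<open>otherwise \<open>V\<close> would contain a copy of the power set of \<open>Pow \<nat>\<close>\<close>
  have "\<exists>\<A>. ultrafilter_mass (W \<A>) \<notin> V"
  proof (rule ccontr)
    assume "\<nexists>\<A>. ultrafilter_mass (W \<A>) \<notin> V"
    then have "range (\<lambda>\<A>. ultrafilter_mass (W \<A>)) \<subseteq> V" by auto
    moreover have "inj (\<lambda>\<A>. ultrafilter_mass (W \<A>) :: nat set \<Rightarrow> 'k)"
      using W(1) by (auto simp: inj_def dest: ultrafilter_mass_inject)
    ultimately have "(UNIV :: nat set set set) \<lesssim> V" by (auto simp: lepoll_def)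
    also have "V \<lesssim> (UNIV :: 'k expr set)" unfolding V_def by (rule image_lepoll)
    also have "\<dots> \<lesssim> (UNIV :: nat set set)" using small by (rule expr_lepoll_nat_sets)
    finally have "(UNIV :: nat set set set) \<lesssim> (UNIV :: nat set set)" .
    then show False
      using lesspoll_Pow_self[of "UNIV :: nat set set"]
      by (auto simp: lesspoll_def dest: lepoll_antisym)
  qed
  then obtain U2 where U2: "ultrafilter U2" and notin: "ultrafilter_mass U2 \<notin> V"
    using W by blast
  \<comment> \<open>if \<open>U2\<close> were principal, its characteristic function would be a point mass, hence in \<open>V\<close>\<close>
  have "free_filter U2"
  proof (rule free_filterI, rule ccontr)
    fix m assume "\<not> eventually (\<lambda>n. n \<noteq> m) U2"
    then have m: "eventually (\<lambda>n. n = m) U2" using ultrafilter_cases[OF U2, of "\<lambda>n. n \<noteq> m"] by simp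
    have "eventually (\<lambda>n. n \<in> A) U2 \<longleftrightarrow> m \<in> A" for A
    proof
      assume "eventually (\<lambda>n. n \<in> A) U2"
      with m have "eventually (\<lambda>_. m \<in> A) U2" by eventually_elim simp
      then show "m \<in> A" using U2 by (simp add: ultrafilter_def)
    next
      assume "m \<in> A"
      with m show "eventually (\<lambda>n. n \<in> A) U2" by (auto elim: eventually_mono)
    qed
    then have "ultrafilter_mass U2 = (point_mass m :: _ \<Rightarrow> 'k)"
      by (simp add: fun_eq_iff ultrafilter_mass_def point_mass_def)
    then show False using notin pm by simp
  qed
  moreover have "\<not> Compl U2 (function_module V) (top_of_set V)"
  proof
    assume c: "Compl U2 (function_module V) (top_of_set V)"
    have r: "range point_mass \<subseteq> V" using pm by blast
    have "Cauchy_over (function_module V) (top_of_set V) U2 point_mass"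
      by (rule V.pointwise_convergent_imp_Cauchy_over[OF point_mass_tendsto[OF U2] r])
    then obtain y where y: "y \<in> V" "limitin (top_of_set V) point_mass y U2"
      using c r unfolding Compl_def carrier_function_module by blast
    have "y A = ultrafilter_mass U2 A" for A
    proof (rule tendsto_unique)
      show "U2 \<noteq> bot" using U2 by (simp add: ultrafilter_def)
      show "((\<lambda>n. point_mass n A) \<longlongrightarrow> y A) U2" using y V.limitin_iff[OF r] by blast
      show "((\<lambda>n. point_mass n A) \<longlongrightarrow> ultrafilter_mass U2 A) U2"
        by (rule point_mass_tendsto[OF U2])
    qed
    then have "y = ultrafilter_mass U2" by (rule ext)
    then show False using notin y by simp
  qed
  ultimately show ?thesis using U1 U2 compl V.hausdorff_tvs by blast
qed

lemma real_lepoll_nat_sets: "(UNIV :: real set) \<lesssim> (UNIV :: nat set set)"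
  using nat_sets_eqpoll_reals by (meson eqpoll_sym eqpoll_imp_lepoll)

lemma complex_lepoll_nat_sets: "(UNIV :: complex set) \<lesssim> (UNIV :: nat set set)"
proof -
  have "(UNIV :: complex set) \<lesssim> (UNIV :: real set) \<times> (UNIV :: real set)"
    by (auto simp: lepoll_def inj_def complex_eq_iff intro!: exI[of _ "\<lambda>z. (Re z, Im z)"])
  also have "\<dots> \<lesssim> (UNIV :: nat set set)"
    by (intro Times_lepoll_infinite real_lepoll_nat_sets) (simp add: Finite_Set.finite_set)
  finally show ?thesis .
qed

theorem theorem4p14:
  assumes "martin_axiom"
  shows "(\<exists>(U1 :: nat filter) (U2 :: nat filter) (X :: (real, nat set \<Rightarrow> real) module) T.
            ultrafilter U1 \<and> free_filter U1 \<and> ultrafilter U2 \<and> free_filter U2 \<and>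
            hausdorff_tvs X T \<and> Compl U1 X T \<and> \<not> Compl U2 X T) \<and>
         (\<exists>(U1 :: nat filter) (U2 :: nat filter) (X :: (complex, nat set \<Rightarrow> complex) module) T.
            ultrafilter U1 \<and> free_filter U1 \<and> ultrafilter U2 \<and> free_filter U2 \<and>
            hausdorff_tvs X T \<and> Compl U1 X T \<and> \<not> Compl U2 X T)"
  using separating_tvs[OF real_lepoll_nat_sets] separating_tvs[OF complex_lepoll_nat_sets]
  by (rule conjI)

end
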